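(* Let $m\ge 1$ be an integer. For scheduling with uncertain processing times on $m$ machines with the objective of minimizing the total completion time, let $\beta=2$ and, with $r_k=u_k/t_k$, let $\mathbb P_k=0$ if $r_k<1$, $\mathbb P_k=1$ if $r_k>3$, and $$\mathbb P_k=\frac{(\beta+1)(r_k-1)}{\beta\left(\max\{\frac{2}{r_k}+1,\ \frac{\beta}{r_k},\ (1+\frac1\beta)(1+\frac1{r_k})\}-\max\{2,\ \beta,\ 1+\frac1\beta\}+r_k-1\right)+r_k-1}$$ if $r_k\in[1,3]$. Then the algorithm $\beta$-RPCPM with these testing probabilities has expected competitive ratio at most $$2.152271\cdot\left(\frac12+\frac1{2m}\right)+1.434847\cdot\left(1-\frac1m\right),$$ which is $2.152271$ when $m=1$ and tends to approximately $2.510983$ as $m$ tends to infinity.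
   Context: Problem. There are $n$ jobs, all available at time $0$, and $m$ identical machines, each of which runs one task at a time. Job $j$ has a testing time $t_j> 0$, an upper limit $u_j> 0$, and a real processing time $p_j\in[0,u_j]$. A job may be executed untested, which takes $u_j$ time units, or it may be tested (taking $t_j$ time units) and afterwards, once the test is finished, executed in $p_j$ time units; other tasks may run between the test and the execution, and the test and the execution of a job may be on different machines. The completion time of a job is the time at which its execution (or execution-untested) ends, and the cost of a schedule is the sum of the completion times of all jobs. An online algorithm knows all $t_j,u_j$ from the start, but learns $p_j$ only when the test of $j$ is finished. $\mathrm{OPT}$ knows all $p_j$ in advance (but must still test $j$ in order to run it in time $p_j$), and its cost is the minimum cost of any schedule. The expected competitive ratio of a randomized online algorithm $A$ is the smallest $c$ such that $\mathbb E[\mathrm{cost}(A)]\le c\cdot\mathrm{cost}(\mathrm{OPT})$ on all instances. Algorithm $\beta$-RPCPM with testing probabilities $\mathbb P_j$. Maintain a priority queue of tasks, smaller weight meaning higher priority (ties broken arbitrarily). Initially, for each job $j$, independently: with probability $\mathbb P_j$ insert a testing task of weight $\beta t_j$ (job $j$ is tested), and with probability $1-\mathbb P_j$ insert an execution-untested task of weight $u_j$ (job $j$ is not tested). All machines are idle at time $0$. Whenever a machine becomes idle: if the task it has just finished was the testing task of a job $i$, insert the execution task of $i$ (of duration $p_i$) with weight $t_i+p_i$ into the queue; then extract a task of smallest weight from the queue (if it is nonempty) and run it, without interruption, on this machine. *)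

theory Defs
  imports "HOL-Probability.Probability"
begin

record problem =
  jobs :: nat
  test_time :: "nat \<Rightarrow> real"
  upper :: "nat \<Rightarrow> real"
  proc :: "nat \<Rightarrow> real"

definition valid :: "problem \<Rightarrow> bool" where
  "valid I \<longleftrightarrow> (\<forall>j<jobs I. test_time I j > 0 \<and> upper I j > 0 \<and> proc I j \<in> {0..upper I j})"

datatype task = Test nat | Exec nat | Untested nat

fun duration :: "problem \<Rightarrow> task \<Rightarrow> real" where
  "duration I (Test j) = test_time I j"
| "duration I (Exec j) = proc I j"
| "duration I (Untested j) = upper I j"

text \<open>A schedule maps each task that is run to its machine and its starting time.\<close>

type_synonym schedule = "task \<Rightarrow> (nat \<times> real) option"

definition completion :: "problem \<Rightarrow> schedule \<Rightarrow> nat \<Rightarrow> real" where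
  "completion I S j =
     (let x = (if Untested j \<in> dom S then Untested j else Exec j)
      in snd (the (S x)) + duration I x)"

definition cost :: "problem \<Rightarrow> schedule \<Rightarrow> real" where
  "cost I S = (\<Sum>j<jobs I. completion I S j)"

definition feasible :: "nat \<Rightarrow> problem \<Rightarrow> schedule \<Rightarrow> bool" where
  "feasible m I S \<longleftrightarrow>
     (\<exists>A \<subseteq> {..<jobs I}. dom S = Test ` A \<union> Exec ` A \<union> Untested ` ({..<jobs I} - A)) \<and>
     (\<forall>x i s. S x = Some (i, s) \<longrightarrow> i < m \<and> 0 \<le> s) \<and>
     (\<forall>j i s i' s'. S (Test j) = Some (i, s) \<and> S (Exec j) = Some (i', s')
        \<longrightarrow> s + test_time I j \<le> s') \<and>
     (\<forall>x y i s s'. S x = Some (i, s) \<and> S y = Some (i, s') \<and> x \<noteq> y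
        \<longrightarrow> s + duration I x \<le> s' \<or> s' + duration I y \<le> s)"

text \<open>For a valid instance and \<open>m \<ge> 1\<close> this infimum is over a nonempty set bounded below by 0,
  and it is attained.\<close>

definition opt :: "nat \<Rightarrow> problem \<Rightarrow> real" where
  "opt m I = Inf {cost I S | S. feasible m I S}"

fun weight :: "real \<Rightarrow> problem \<Rightarrow> task \<Rightarrow> real" where
  "weight \<beta> I (Test j) = \<beta> * test_time I j"
| "weight \<beta> I (Exec j) = test_time I j + proc I j"
| "weight \<beta> I (Untested j) = upper I j"

text \<open>
  A state \<open>(Q, R, S)\<close> of the algorithm consists of the queue \<open>Q\<close>, the busy machines \<open>R\<close> and the
  schedule \<open>S\<close> built so far.  If machine \<open>i\<close> is busy, \<open>R i = Some (x, \<tau>)\<close> means that it becomes idle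
  at time \<open>\<tau>\<close>, having then finished the task \<open>x\<close>; all machines start with \<open>(None, 0)\<close>.
  Each step handles an earliest moment at which a machine becomes idle.  A machine that finds the
  queue empty does nothing from then on: the queue only grows when a machine finishes a test, and
  that machine extracts a task at once.  Ties, both between weights and between machines becoming
  idle simultaneously, are resolved nondeterministically.
\<close>

type_synonym state = "task set \<times> (nat \<Rightarrow> (task option \<times> real) option) \<times> schedule"

fun released :: "task option \<Rightarrow> task set" where
  "released (Some (Test j)) = {Exec j}"
| "released _ = {}"

definition next_idle :: "(nat \<Rightarrow> (task option \<times> real) option) \<Rightarrow> nat \<Rightarrow> task option \<Rightarrow> real \<Rightarrow> bool" where
  "next_idle R i x \<tau> \<longleftrightarrow>
     R i = Some (x, \<tau>) \<and> (\<forall>i' x' \<tau>'. R i' = Some (x', \<tau>') \<longrightarrow> \<tau> \<le> \<tau>')"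

inductive rpcpm_step :: "real \<Rightarrow> problem \<Rightarrow> state \<Rightarrow> state \<Rightarrow> bool" for \<beta> I where
  start: "\<lbrakk>next_idle R i x \<tau>; Q' = Q \<union> released x;
      y \<in> Q'; \<forall>z\<in>Q'. weight \<beta> I y \<le> weight \<beta> I z\<rbrakk> \<Longrightarrow>
    rpcpm_step \<beta> I (Q, R, S)
      (Q' - {y}, R(i \<mapsto> (Some y, \<tau> + duration I y)), S(y \<mapsto> (i, \<tau>)))"
| stop: "\<lbrakk>next_idle R i x \<tau>; Q \<union> released x = {}\<rbrakk> \<Longrightarrow>
    rpcpm_step \<beta> I (Q, R, S) (Q, R(i := None), S)"

text \<open>The function \<open>b\<close> records the outcomes of the coin flips: \<open>b j\<close> means that job \<open>j\<close> is tested.\<close>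

definition initial :: "nat \<Rightarrow> problem \<Rightarrow> (nat \<Rightarrow> bool) \<Rightarrow> state" where
  "initial m I b =
     ((\<lambda>j. if b j then Test j else Untested j) ` {..<jobs I},
      (\<lambda>i. if i < m then Some (None, 0) else None),
      Map.empty)"

definition rpcpm_run :: "real \<Rightarrow> nat \<Rightarrow> problem \<Rightarrow> (nat \<Rightarrow> bool) \<Rightarrow> schedule \<Rightarrow> bool" where
  "rpcpm_run \<beta> m I b S \<longleftrightarrow> (\<exists>Q. (rpcpm_step \<beta> I)\<^sup>*\<^sup>* (initial m I b) (Q, Map.empty, S))"

text \<open>Job \<open>j\<close> is tested with probability \<open>pr (upper I j / test_time I j)\<close>; \<open>\<sigma> b\<close> is the schedule
  produced for the coin flips \<open>b\<close>.\<close>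

definition expected_cost :: "(real \<Rightarrow> real) \<Rightarrow> problem \<Rightarrow> ((nat \<Rightarrow> bool) \<Rightarrow> schedule) \<Rightarrow> real" where
  "expected_cost pr I \<sigma> =
     measure_pmf.expectation
       (Pi_pmf {..<jobs I} False (\<lambda>j. bernoulli_pmf (pr (upper I j / test_time I j))))
       (\<lambda>b. cost I (\<sigma> b))"

text \<open>Since ties are broken arbitrarily, the bound is demanded for every choice \<open>\<sigma>\<close> of runs,
  even if the ties are broken differently for different coin flips.\<close>

definition rpcpm_competitive :: "real \<Rightarrow> (real \<Rightarrow> real) \<Rightarrow> nat \<Rightarrow> real \<Rightarrow> bool" where
  "rpcpm_competitive \<beta> pr m c \<longleftrightarrow>
     (\<forall>I \<sigma>. valid I \<and> (\<forall>b. rpcpm_run \<beta> m I b (\<sigma> b)) \<longrightarrow> expected_cost pr I \<sigma> \<le> c * opt m I)"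

text \<open>The value is \<open>\<infinity>\<close> if the algorithm is not competitive.\<close>

definition rpcpm_ratio :: "real \<Rightarrow> (real \<Rightarrow> real) \<Rightarrow> nat \<Rightarrow> ereal" where
  "rpcpm_ratio \<beta> pr m = Inf {ereal c | c. rpcpm_competitive \<beta> pr m c}"

definition test_prob :: "real \<Rightarrow> real \<Rightarrow> real" where
  "test_prob \<beta> r =
     (if r < 1 then 0 else if r > 3 then 1
      else (\<beta> + 1) * (r - 1) /
        (\<beta> * (Max {2 / r + 1, \<beta> / r, (1 + 1 / \<beta>) * (1 + 1 / r)} - Max {2, \<beta>, 1 + 1 / \<beta>} + r - 1)
          + r - 1))"

definition ratio_bound :: "nat \<Rightarrow> real" where
  "ratio_bound m = 2.152271 * (1 / 2 + 1 / (2 * real m)) + 1.434847 * (1 - 1 / real m)"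

end

theory Submission
  imports Defs
begin

text \<open>
  Let \<open>\<rho> j = min (u j) (t j + p j)\<close>. For any schedule on \<open>m\<close> machines, \<open>2 * m * cost\<close> is at least
  the sum of \<open>min (\<rho> i) (\<rho> j)\<close> over all pairs \<open>(i, j)\<close> plus \<open>m\<close> times the sum of the \<open>\<rho> j\<close> (the bound
  of Eastman, Even and Isaacs). As the test and the execution of a job may be separated, this is proved
  through mean busy times: on one machine it is a pairwise estimate with the kernel
  \<open>min (1 / q i) (1 / q j)\<close>, and the machines are combined by the Cauchy-Schwarz inequality for this
  positive semidefinite kernel.

  In a run of the algorithm, a job completes no later than \<open>1 / m\<close> times the work that other jobs
  contribute before it, plus its own work. The mutual delay of two jobs is bounded by a quantity that
  depends on the coin flip of only one of them, and this for either choice of the one. Hence the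
  expected mutual delay is at most \<open>2.152271 * min (\<rho> i) (\<rho> j)\<close>, while the expected own work is at
  most \<open>1.434847 * \<rho> j\<close>. The constants are rounded from \<open>3 / 2 * (1 + c)\<close> and \<open>1 + c\<close>, where \<open>c\<close> is
  the maximum of \<open>test_prob 2 r / r\<close> on \<open>[1, 3]\<close>.
\<close>

section \<open>A lower bound for the optimum\<close>

text \<open>Induction by starting time: if the last interval has positive length, all others end by
  its start, which then takes the place of \<open>T\<close>. An interval of length 0 is just
  dropped, as a longer one may start at the same moment. The inserted element may already be in the
  set, hence the splits on \<open>x \<in> X\<close>.\<close>

lemma sum_durations_le:
  fixes s d :: "'a \<Rightarrow> real"
  assumes "finite X"
    and "\<And>x. x \<in> X \<Longrightarrow> 0 \<le> s x \<and> 0 \<le> d x \<and> s x + d x \<le> T"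
    and "\<And>x y. x \<in> X \<Longrightarrow> y \<in> X \<Longrightarrow> x \<noteq> y \<Longrightarrow> s x + d x \<le> s y \<or> s y + d y \<le> s x"
    and "0 \<le> T"
  shows "sum d X \<le> T"
  using assms
proof (induction X arbitrary: T rule: finite_ranking_induct[where f = s])
  case empty
  then show ?case by simp
next
  case (insert x X)
  show ?case
  proof (cases "d x = 0")
    case True
    have "sum d X \<le> T"
      using insert.prems by (intro insert.IH) auto
    with True insert.hyps show ?thesis by (cases "x \<in> X") (auto simp: insert_absorb)
  next
    case False
    have "sum d X \<le> s x" if "x \<notin> X"
    proof (rule insert.IH)
      fix y assume y: "y \<in> X"
      have "s y + d y \<le> s x"
        using insert.prems(1)[of x] insert.prems(2)[of x y] insert.hyps(2)[OF y] y that False by force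
      then show "0 \<le> s y \<and> 0 \<le> d y \<and> s y + d y \<le> s x"
        using insert.prems(1)[of y] y by auto
    qed (use insert.prems in auto)
    moreover have "sum d X \<le> T" if "x \<in> X"
      using insert.prems by (intro insert.IH) auto
    ultimately show ?thesis
      using insert.hyps insert.prems(1)[of x] by (cases "x \<in> X") (auto simp: insert_absorb)
  qed
qed

text \<open>Each pair of distinct tasks is charged to the later one, at the weight of that task;
  this is \<open>B\<close>. The tasks before \<open>x\<close> have total length at most
  \<open>s x\<close>, and the diagonal supplies the rest of twice the midpoint
  \<open>s x + d x / 2\<close>.\<close>

lemma machine_busy_times:
  fixes s d w :: "'a \<Rightarrow> real"
  assumes "finite X"
    and nonneg: "\<And>x. x \<in> X \<Longrightarrow> 0 \<le> s x \<and> 0 \<le> d x \<and> 0 \<le> w x"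
    and disj: "\<And>x y. x \<in> X \<Longrightarrow> y \<in> X \<Longrightarrow> x \<noteq> y \<Longrightarrow> s x + d x \<le> s y \<or> s y + d y \<le> s x"
  shows "(\<Sum>x\<in>X. \<Sum>y\<in>X. d x * d y * min (w x) (w y)) \<le> 2 * (\<Sum>x\<in>X. w x * d x * (s x + d x / 2))"
proof -
  define B where "B x y = (if y \<noteq> x \<and> s y + d y \<le> s x then w x * d x * d y else 0)" for x y
  have B: "(\<Sum>y\<in>X. B x y) \<le> w x * d x * s x" if x: "x \<in> X" for x
  proof -
    have "(\<Sum>y\<in>X. B x y) = w x * d x * sum d {y\<in>X. y \<noteq> x \<and> s y + d y \<le> s x}"
      unfolding B_def by (simp add: sum.inter_filter[symmetric] \<open>finite X\<close> sum_distrib_left)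
    also have "\<dots> \<le> w x * d x * s x"
    proof (rule mult_left_mono)
      show "sum d {y\<in>X. y \<noteq> x \<and> s y + d y \<le> s x} \<le> s x"
        using \<open>finite X\<close> nonneg x by (intro sum_durations_le[where s = s] disj) auto
      show "0 \<le> w x * d x"
        using nonneg[OF x] by simp
    qed
    finally show ?thesis .
  qed
  have "d x * d y * min (w x) (w y) \<le> B x y + B y x + (if y = x then w x * d x * d x else 0)"
    if "x \<in> X" "y \<in> X" for x y
  proof (cases "x = y")
    case False
    have "0 \<le> d x * d y" "0 \<le> w x * d x * d y" "0 \<le> w y * d y * d x"
      using nonneg that by simp_all
    moreover have "d x * d y * min (w x) (w y) \<le> d x * d y * w x"
      "d x * d y * min (w x) (w y) \<le> d x * d y * w y"
      using \<open>0 \<le> d x * d y\<close> by (auto intro!: mult_left_mono)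
    ultimately show ?thesis
      using disj[OF that False] by (auto simp: B_def ac_simps)
  qed (simp add: B_def)
  then have "(\<Sum>x\<in>X. \<Sum>y\<in>X. d x * d y * min (w x) (w y))
      \<le> (\<Sum>x\<in>X. \<Sum>y\<in>X. B x y + B y x + (if y = x then w x * d x * d x else 0))"
    by (intro sum_mono) auto
  also have "\<dots> = (\<Sum>x\<in>X. \<Sum>y\<in>X. B x y) + (\<Sum>x\<in>X. \<Sum>y\<in>X. B y x) + (\<Sum>x\<in>X. w x * d x * d x)"
    using \<open>finite X\<close> by (simp add: sum.distrib)
  also have "(\<Sum>x\<in>X. \<Sum>y\<in>X. B y x) = (\<Sum>x\<in>X. \<Sum>y\<in>X. B x y)"
    by (rule sum.swap)
  also have "(\<Sum>x\<in>X. \<Sum>y\<in>X. B x y) + (\<Sum>x\<in>X. \<Sum>y\<in>X. B x y) + (\<Sum>x\<in>X. w x * d x * d x)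
      \<le> (\<Sum>x\<in>X. w x * d x * s x) + (\<Sum>x\<in>X. w x * d x * s x) + (\<Sum>x\<in>X. w x * d x * d x)"
    using B by (intro add_mono sum_mono) auto
  also have "\<dots> = 2 * (\<Sum>x\<in>X. w x * d x * (s x + d x / 2))"
    unfolding sum_distrib_left sum.distrib[symmetric]
    by (intro sum.cong refl) (simp add: field_simps)
  finally show ?thesis .
qed

text \<open>The layer-cake principle: on a threshold set of \<open>w\<close>, the kernel is a constant.\<close>

lemma sum_min_kernel_nonneg:
  fixes w :: "'a \<Rightarrow> real" and c :: "'a \<Rightarrow> 'a \<Rightarrow> real"
  assumes "finite A" "\<And>x. x \<in> A \<Longrightarrow> 0 \<le> w x"
    and "\<And>B. B \<subseteq> A \<Longrightarrow> 0 \<le> (\<Sum>x\<in>B. \<Sum>y\<in>B. c x y)"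
  shows "0 \<le> (\<Sum>x\<in>A. \<Sum>y\<in>A. c x y * min (w x) (w y))"
  using assms
proof (induction A arbitrary: w rule: finite_psubset_induct)
  case (psubset A)
  show ?case
  proof (cases "A = {}")
    case False
    \<comment> \<open>The lowest layer is peeled off: it contributes \<open>v\<close> times the
      plain sum of \<open>c\<close> over \<open>A\<close>. After \<open>v\<close> is subtracted, the
      row and the column of the minimiser \<open>a\<close> vanish, which leaves a smaller
      set.\<close>
    define v where "v = Min (w ` A)"
    have "v \<in> w ` A"
      unfolding v_def using psubset.hyps False by (intro Min_in) auto
    then obtain a where a: "a \<in> A" "w a = v" by auto
    have v: "v \<le> w x" if "x \<in> A" for x
      unfolding v_def using psubset.hyps that by (intro Min_le) auto
    let ?c = "\<lambda>x y. c x y * min (w x - v) (w y - v)"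
    have 1: "min (w x - v) (w y - v) = 0" if "x = a \<or> y = a" "x \<in> A" "y \<in> A" for x y
      using that a v[of x] v[of y] by (auto simp: min_def)
    have "(\<Sum>x\<in>A. \<Sum>y\<in>A. c x y * min (w x) (w y)) = (\<Sum>x\<in>A. \<Sum>y\<in>A. v * c x y + ?c x y)"
      by (intro sum.cong refl) (auto simp: min_def algebra_simps)
    also have "\<dots> = v * (\<Sum>x\<in>A. \<Sum>y\<in>A. c x y) + (\<Sum>x\<in>A. \<Sum>y\<in>A. ?c x y)"
      by (simp add: sum.distrib sum_distrib_left)
    also have "(\<Sum>x\<in>A. \<Sum>y\<in>A. ?c x y) = (\<Sum>x\<in>A-{a}. \<Sum>y\<in>A-{a}. ?c x y)"
    proof -
      have "(\<Sum>x\<in>A. \<Sum>y\<in>A. ?c x y) = (\<Sum>x\<in>A-{a}. \<Sum>y\<in>A. ?c x y)"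
        using psubset.hyps 1 a by (intro sum.mono_neutral_right) (auto intro!: sum.neutral)
      also have "\<dots> = (\<Sum>x\<in>A-{a}. \<Sum>y\<in>A-{a}. ?c x y)"
        using psubset.hyps 1 a by (intro sum.cong refl sum.mono_neutral_right) auto
      finally show ?thesis .
    qed
    moreover have "0 \<le> (\<Sum>x\<in>A-{a}. \<Sum>y\<in>A-{a}. ?c x y)"
      using a v psubset.prems(2) by (intro psubset.IH) auto
    moreover have "0 \<le> v * (\<Sum>x\<in>A. \<Sum>y\<in>A. c x y)"
      using psubset.prems a by (intro mult_nonneg_nonneg) auto
    ultimately show ?thesis by linarith
  qed simp
qed

text \<open>Cauchy-Schwarz over the \<open>m\<close> group totals \<open>D l\<close>, whose squares
  are the sums over pairs within a group.\<close>

lemma sum_square_groups_le: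
  fixes d :: "'a \<Rightarrow> real" and f :: "'a \<Rightarrow> nat"
  assumes "finite B" "\<And>x. x \<in> B \<Longrightarrow> f x < m"
  shows "(\<Sum>x\<in>B. d x)\<^sup>2 \<le> real m * (\<Sum>x\<in>B. \<Sum>y\<in>B. if f x = f y then d x * d y else 0)"
proof -
  define D where "D l = sum d {x\<in>B. f x = l}" for l
  have im: "f ` B \<subseteq> {..<m}" using assms(2) by auto
  have "(\<Sum>x\<in>B. d x) = (\<Sum>l<m. D l)"
    unfolding D_def using sum.group[OF assms(1) _ im, of d] by simp
  also have "\<dots>\<^sup>2 \<le> real m * (\<Sum>l<m. (D l)\<^sup>2)"
    using sum_squared_le_sum_of_squares[of D "{..<m}"] by (simp add: mult.commute)
  also have "(\<Sum>l<m. (D l)\<^sup>2) = (\<Sum>l<m. \<Sum>x | x \<in> B \<and> f x = l. d x * D (f x))"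
    by (intro sum.cong refl) (simp add: D_def power2_eq_square sum_distrib_right)
  also have "\<dots> = (\<Sum>x\<in>B. d x * D (f x))"
    using sum.group[OF assms(1) _ im, of "\<lambda>x. d x * D (f x)"] by simp
  also have "\<dots> = (\<Sum>x\<in>B. \<Sum>y\<in>B. if f x = f y then d x * d y else 0)"
    unfolding D_def
    by (auto simp: sum_distrib_left sum.inter_filter assms(1) eq_commute intro!: sum.cong)
  finally show ?thesis by simp
qed

text \<open>By \<open>sum_square_groups_le\<close>, the kernel \<open>?c\<close> has a nonnegative
  sum over every set of tasks, and \<open>sum_min_kernel_nonneg\<close> carries this over to the
  weights. So all pairs together cost at most \<open>m\<close> times the pairs on a common machine,
  to which \<open>machine_busy_times\<close> applies.\<close>

lemma parallel_busy_times:
  fixes s d w :: "'a \<Rightarrow> real" and f :: "'a \<Rightarrow> nat"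
  assumes "finite X" "\<And>x. x \<in> X \<Longrightarrow> f x < m"
    and nonneg: "\<And>x. x \<in> X \<Longrightarrow> 0 \<le> s x \<and> 0 \<le> d x \<and> 0 \<le> w x"
    and disj: "\<And>x y. x \<in> X \<Longrightarrow> y \<in> X \<Longrightarrow> x \<noteq> y \<Longrightarrow> f x = f y \<Longrightarrow>
      s x + d x \<le> s y \<or> s y + d y \<le> s x"
  shows "(\<Sum>x\<in>X. \<Sum>y\<in>X. d x * d y * min (w x) (w y)) \<le> 2 * real m * (\<Sum>x\<in>X. w x * d x * (s x + d x / 2))"
proof -
  have im: "f ` X \<subseteq> {..<m}" using assms(2) by auto
  let ?k = "\<lambda>x y. d x * d y * min (w x) (w y)"
  let ?c = "\<lambda>x y. d x * d y * ((if f x = f y then real m else 0) - 1)"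
  have "0 \<le> (\<Sum>x\<in>X. \<Sum>y\<in>X. ?c x y * min (w x) (w y))"
  proof (rule sum_min_kernel_nonneg)
    fix B assume "B \<subseteq> X"
    then have "(\<Sum>x\<in>B. d x)\<^sup>2 \<le> real m * (\<Sum>x\<in>B. \<Sum>y\<in>B. if f x = f y then d x * d y else 0)"
      using assms(1,2) by (intro sum_square_groups_le) (auto intro: finite_subset)
    also have "\<dots> = (\<Sum>x\<in>B. \<Sum>y\<in>B. ?c x y + d x * d y)"
      unfolding sum_distrib_left by (intro sum.cong refl) (simp add: algebra_simps)
    also have "\<dots> = (\<Sum>x\<in>B. \<Sum>y\<in>B. ?c x y) + (\<Sum>x\<in>B. d x)\<^sup>2"
      by (simp add: sum.distrib power2_eq_square sum_product)
    finally show "0 \<le> (\<Sum>x\<in>B. \<Sum>y\<in>B. ?c x y)" by simp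
  qed (use assms in auto)
  also have "\<dots> = (\<Sum>x\<in>X. \<Sum>y\<in>X. real m * (if f x = f y then ?k x y else 0) - ?k x y)"
    by (intro sum.cong refl) (simp add: algebra_simps)
  also have "\<dots> = real m * (\<Sum>x\<in>X. \<Sum>y\<in>X. if f x = f y then ?k x y else 0) - (\<Sum>x\<in>X. \<Sum>y\<in>X. ?k x y)"
    by (simp add: sum_subtractf sum_distrib_left)
  finally have le: "(\<Sum>x\<in>X. \<Sum>y\<in>X. ?k x y) \<le> real m * (\<Sum>x\<in>X. \<Sum>y\<in>X. if f x = f y then ?k x y else 0)"
    by simp
  have "(\<Sum>x\<in>X. \<Sum>y\<in>X. if f x = f y then ?k x y else 0)
      = (\<Sum>l<m. \<Sum>x | x \<in> X \<and> f x = l. \<Sum>y\<in>X. if f x = f y then ?k x y else 0)"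
    by (rule sum.group[OF assms(1) _ im, symmetric]) simp
  also have "\<dots> = (\<Sum>l<m. \<Sum>x | x \<in> X \<and> f x = l. \<Sum>y | y \<in> X \<and> f y = l. ?k x y)"
    by (auto simp: sum.inter_filter assms(1) eq_commute intro!: sum.cong)
  also have "\<dots> \<le> (\<Sum>l<m. 2 * (\<Sum>x | x \<in> X \<and> f x = l. w x * d x * (s x + d x / 2)))"
    using assms by (intro sum_mono machine_busy_times) auto
  also have "\<dots> = 2 * (\<Sum>x\<in>X. w x * d x * (s x + d x / 2))"
    unfolding sum_distrib_left[symmetric]
    using sum.group[OF assms(1) _ im, of "\<lambda>x. w x * d x * (s x + d x / 2)"] by simp
  finally have "(\<Sum>x\<in>X. \<Sum>y\<in>X. if f x = f y then ?k x y else 0)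
      \<le> 2 * (\<Sum>x\<in>X. w x * d x * (s x + d x / 2))" .
  from le mult_left_mono[OF this, of "real m"] show ?thesis by simp
qed

section \<open>Work of a job and lower bounds over feasible schedules\<close>

text \<open>Here and in \<open>tasks\<close>, \<open>b\<close> stands for the testing decisions of
  an arbitrary schedule as well as for the coin flips of the algorithm.\<close>

definition work :: "problem \<Rightarrow> (nat \<Rightarrow> bool) \<Rightarrow> nat \<Rightarrow> real" where
  "work I b j = (if b j then test_time I j + proc I j else upper I j)"

definition min_work :: "problem \<Rightarrow> nat \<Rightarrow> real" where
  "min_work I j = min (upper I j) (test_time I j + proc I j)"

fun job_of :: "task \<Rightarrow> nat" where
  "job_of (Test j) = j" | "job_of (Exec j) = j" | "job_of (Untested j) = j"

definition tasks :: "(nat \<Rightarrow> bool) \<Rightarrow> nat \<Rightarrow> task set" where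
  "tasks b j = (if b j then {Test j, Exec j} else {Untested j})"

lemma finite_tasks [simp]: "finite (tasks b j)"
  by (simp add: tasks_def)

lemma job_of_tasks: "x \<in> tasks b j \<Longrightarrow> job_of x = j"
  by (auto simp: tasks_def split: if_splits)

lemma sum_tasks: "(\<Sum>x\<in>(\<Union>j<n. tasks b j). f x) = (\<Sum>j<n. \<Sum>x\<in>tasks b j. f x)"
  by (rule sum.UNION_disjoint) (auto dest: job_of_tasks)

lemma sum_duration_tasks: "(\<Sum>x\<in>tasks b j. duration I x) = work I b j"
  by (simp add: tasks_def work_def)

lemma validD:
  assumes "valid I" "j < jobs I"
  shows "0 < test_time I j" "0 < upper I j" "0 \<le> proc I j" "proc I j \<le> upper I j"
  using assms by (auto simp: valid_def)

lemma duration_nonneg: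
  assumes "valid I" "job_of x < jobs I"
  shows "0 \<le> duration I x"
  using validD[OF assms] by (cases x) auto

lemma min_work_pos:
  assumes "valid I" "j < jobs I"
  shows "0 < min_work I j"
  using validD[OF assms] by (simp add: min_work_def)

lemma min_work_le_work: "min_work I j \<le> work I b j"
  by (simp add: min_work_def work_def)

lemma feasible_cost_lower_bound:
  assumes I: "valid I" and S: "feasible m I S"
  shows "(\<Sum>j<jobs I. min_work I j) \<le> cost I S"
    and "(\<Sum>i<jobs I. \<Sum>j<jobs I. min (min_work I i) (min_work I j)) + real m * (\<Sum>j<jobs I. min_work I j)
      \<le> 2 * real m * cost I S"
proof -
  let ?n = "jobs I"
  obtain A where A: "A \<subseteq> {..<?n}" "dom S = Test ` A \<union> Exec ` A \<union> Untested ` ({..<?n} - A)"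
    using S unfolding feasible_def by blast
  define b where "b j \<longleftrightarrow> j \<in> A" for j
  define q where "q = work I b"
  define f where "f x = fst (the (S x))" for x
  define s where "s x = snd (the (S x))" for x
  have dom: "dom S = (\<Union>j<?n. tasks b j)"
    using A by (auto simp: tasks_def b_def split: if_splits)
  have Sx: "S x = Some (f x, s x)" if "x \<in> dom S" for x
    using that by (auto simp: f_def s_def)
  have fs: "f x < m" "0 \<le> s x" if "x \<in> dom S" for x
    using S Sx[OF that] unfolding feasible_def by blast+
  have prec: "s (Test j) + test_time I j \<le> s (Exec j)" if "j < ?n" "b j" for j
    using S Sx[of "Test j"] Sx[of "Exec j"] that unfolding feasible_def dom
    by (force simp: tasks_def)
  have disj: "s x + duration I x \<le> s y \<or> s y + duration I y \<le> s x"
    if "x \<in> dom S" "y \<in> dom S" "x \<noteq> y" "f x = f y" for x y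
    using S Sx[OF that(1)] Sx[OF that(2)] that(3,4) unfolding feasible_def by metis
  have job: "job_of x < ?n" if "x \<in> dom S" for x
    using that by (auto simp: dom dest: job_of_tasks)
  have q_pos: "0 < q j" if "j < ?n" for j
    using min_work_pos[OF I that] min_work_le_work[of I j b] by (simp add: q_def)
  have comp: "completion I S j = (if b j then s (Exec j) + proc I j else s (Untested j) + upper I j)"
    if "j < ?n" for j
    using A that by (auto simp: completion_def s_def b_def)
  have "min_work I j \<le> completion I S j" if j: "j < ?n" for j
  proof -
    have "q j \<le> completion I S j"
      using prec[OF j] fs(2)[of "Test j"] fs(2)[of "Untested j"] j comp[OF j]
      by (force simp: q_def work_def dom tasks_def split: if_splits)
    then show ?thesis using min_work_le_work[of I j b] by (simp add: q_def)
  qed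
  then show "(\<Sum>j<?n. min_work I j) \<le> cost I S"
    unfolding cost_def by (intro sum_mono) auto

  \<comment> \<open>With weight \<open>1 / q\<close> for every task of a job, the task pairs of two
    jobs add up to \<open>q i * q j * min (1 / q i) (1 / q j)\<close>, which is
    \<open>min (q i) (q j)\<close>, and the weighted midpoints of a job add up to its mean busy
    time.\<close>
  define w where "w x = 1 / q (job_of x)" for x
  text \<open>The mean busy time of a job precedes its completion by at least half of its work.\<close>
  have mean: "(\<Sum>x\<in>tasks b j. w x * duration I x * (s x + duration I x / 2)) + q j / 2 \<le> completion I S j"
    if j: "j < ?n" for j
  proof (cases "b j")
    case True
    define t p where "t = test_time I j" and "p = proc I j"
    have "(\<Sum>x\<in>tasks b j. w x * duration I x * (s x + duration I x / 2))
        = (t * (s (Test j) + t / 2) + p * (s (Exec j) + p / 2)) / q j"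
      using True by (simp add: tasks_def w_def t_def p_def add_divide_distrib)
    \<comment> \<open>The worst case is a test ending exactly when the execution starts. Both tasks
      then form one block with midpoint \<open>s (Exec j) + (p - t) / 2\<close>, which is the
      completion time minus \<open>q j / 2\<close>.\<close>
    moreover have "t * (s (Test j) + t / 2) \<le> t * (s (Exec j) - t / 2)"
      using prec[OF j True] validD[OF I j] by (intro mult_left_mono) (auto simp: t_def)
    then have "(t * (s (Test j) + t / 2) + p * (s (Exec j) + p / 2)) \<le> (s (Exec j) + (p - t) / 2) * q j"
      using True by (simp add: q_def work_def t_def[symmetric] p_def[symmetric] field_simps)
    then have "(t * (s (Test j) + t / 2) + p * (s (Exec j) + p / 2)) / q j \<le> s (Exec j) + (p - t) / 2"
      using q_pos[OF j] by (simp add: divide_le_eq)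
    ultimately show ?thesis
      using True comp[OF j] by (simp add: q_def work_def t_def[symmetric] p_def[symmetric] field_simps)
  next
    case False
    then show ?thesis
      using comp[OF j] q_pos[OF j] by (simp add: tasks_def w_def q_def work_def)
  qed
  have "(\<Sum>i<?n. \<Sum>j<?n. min (q i) (q j))
      = (\<Sum>i<?n. \<Sum>j<?n. \<Sum>x\<in>tasks b i. \<Sum>y\<in>tasks b j. duration I x * duration I y * min (w x) (w y))"
  proof (intro sum.cong refl)
    fix i j assume "i \<in> {..<?n}" "j \<in> {..<?n}"
    then have pos: "0 < q i" "0 < q j" by (auto intro: q_pos)
    have "(\<Sum>x\<in>tasks b i. \<Sum>y\<in>tasks b j. duration I x * duration I y * min (w x) (w y))
        = (\<Sum>x\<in>tasks b i. \<Sum>y\<in>tasks b j. duration I x * duration I y * min (1 / q i) (1 / q j))"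
      by (intro sum.cong refl) (simp add: w_def job_of_tasks)
    also have "\<dots> = q i * q j * min (1 / q i) (1 / q j)"
      by (simp add: sum_distrib_right[symmetric] sum_product[symmetric] sum_duration_tasks q_def)
    also have "\<dots> = min (q i) (q j)"
      using pos by (auto simp: min_def field_simps)
    finally show "min (q i) (q j)
      = (\<Sum>x\<in>tasks b i. \<Sum>y\<in>tasks b j. duration I x * duration I y * min (w x) (w y))" by simp
  qed
  also have "\<dots> = (\<Sum>x\<in>dom S. \<Sum>y\<in>dom S. duration I x * duration I y * min (w x) (w y))"
    unfolding dom sum_tasks by (intro sum.cong refl sum.swap)
  also have "\<dots> \<le> 2 * real m * (\<Sum>x\<in>dom S. w x * duration I x * (s x + duration I x / 2))"
  proof (rule parallel_busy_times)
    show "finite (dom S)" by (simp add: dom)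
    show "0 \<le> s x \<and> 0 \<le> duration I x \<and> 0 \<le> w x" if "x \<in> dom S" for x
      using fs(2)[OF that] duration_nonneg[OF I job[OF that]] q_pos[OF job[OF that]]
      by (simp add: w_def)
  qed (use fs(1) disj in blast)+
  also have "\<dots> \<le> 2 * real m * (\<Sum>j<?n. completion I S j - q j / 2)"
    unfolding dom sum_tasks using mean by (intro mult_left_mono sum_mono) (auto simp: algebra_simps)
  also have "\<dots> = 2 * real m * cost I S - real m * (\<Sum>j<?n. q j)"
    by (simp add: cost_def sum_subtractf sum_divide_distrib[symmetric] algebra_simps)
  finally have "(\<Sum>i<?n. \<Sum>j<?n. min (q i) (q j)) + real m * (\<Sum>j<?n. q j) \<le> 2 * real m * cost I S"
    by simp
  moreover have "(\<Sum>i<?n. \<Sum>j<?n. min (min_work I i) (min_work I j)) \<le> (\<Sum>i<?n. \<Sum>j<?n. min (q i) (q j))"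
    unfolding q_def by (intro sum_mono min.mono min_work_le_work)
  moreover have "real m * (\<Sum>j<?n. min_work I j) \<le> real m * (\<Sum>j<?n. q j)"
    unfolding q_def by (intro mult_left_mono sum_mono min_work_le_work) auto
  ultimately show "(\<Sum>i<?n. \<Sum>j<?n. min (min_work I i) (min_work I j)) + real m * (\<Sum>j<?n. min_work I j)
      \<le> 2 * real m * cost I S" by linarith
qed

text \<open>Makes the infimum in \<open>opt\<close> one over a nonempty set. The witness runs all
  jobs untested, one after another, on machine 0.\<close>

lemma feasible_exists:
  assumes I: "valid I" and m: "1 \<le> m"
  shows "\<exists>S. feasible m I S"
proof -
  define S where "S x = (case x of Untested j \<Rightarrow> if j < jobs I then Some (0::nat, \<Sum>i<j. upper I i) else None
    | _ \<Rightarrow> None)" for x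
  have mono: "(\<Sum>i<j. upper I i) + upper I j \<le> (\<Sum>i<k. upper I i)" if "j < k" "k < jobs I" for j k
  proof -
    have "(\<Sum>i<Suc j. upper I i) \<le> (\<Sum>i<k. upper I i)"
      using that validD(2)[OF I] by (intro sum_mono2) (auto simp: less_imp_le)
    then show ?thesis by simp
  qed
  have "0 \<le> (\<Sum>i<j. upper I i)" if "j < jobs I" for j
    using that validD(2)[OF I] by (intro sum_nonneg) (auto simp: less_imp_le)
  moreover have "dom S = Untested ` {..<jobs I}"
    by (auto simp: S_def split: task.splits if_splits)
  ultimately have "feasible m I S"
    unfolding feasible_def using m mono
    by (intro conjI exI[of _ "{}"] allI impI) (auto simp: S_def split: task.splits if_splits, metis linorder_neqE_nat)
  then show ?thesis by blast
qed

lemma opt_lower_bound: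
  assumes I: "valid I" and m: "1 \<le> m"
  shows "(\<Sum>j<jobs I. min_work I j) \<le> opt m I"
    and "(\<Sum>i<jobs I. \<Sum>j<jobs I. min (min_work I i) (min_work I j)) + real m * (\<Sum>j<jobs I. min_work I j)
      \<le> 2 * real m * opt m I" (is "?L \<le> _")
proof -
  have ne: "{cost I S | S. feasible m I S} \<noteq> {}"
    using feasible_exists[OF assms] by blast
  then show "(\<Sum>j<jobs I. min_work I j) \<le> opt m I"
    unfolding opt_def using feasible_cost_lower_bound(1)[OF I] by (intro cInf_greatest) auto
  have "?L / (2 * real m) \<le> opt m I"
    unfolding opt_def using feasible_cost_lower_bound(2)[OF I] ne m
    by (intro cInf_greatest) (auto simp: divide_le_eq mult_ac)
  then show "?L \<le> 2 * real m * opt m I"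
    using m by (simp add: divide_le_eq mult_ac)
qed

section \<open>The testing probabilities\<close>

lemma test_prob_denom_pos: "0 < 3 * r\<^sup>2 - 4 * r + (3::real)"
proof -
  \<comment> \<open>Completing the square leaves the remainder \<open>5 / 3\<close>.\<close>
  have "0 \<le> 3 * (r - 2 / 3)\<^sup>2" by simp
  then show ?thesis by (simp add: power2_eq_square algebra_simps)
qed

text \<open>For \<open>\<beta> = 2\<close> and \<open>r \<ge> 1\<close> the last entry of the first
  \<open>Max\<close> is the largest, so both maxima disappear.\<close>

lemma test_prob_eq:
  assumes "1 \<le> r" "r \<le> 3"
  shows "test_prob 2 r = 3 * r * (r - 1) / (3 * r\<^sup>2 - 4 * r + 3)"
proof -
  have "2 / r + 1 \<le> 3 / 2 * (1 + 1 / r)" "2 / r \<le> 3 / 2 * (1 + 1 / r)"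
    using assms by (simp_all add: field_simps)
  then have "Max {2 / r + 1, 2 / r, (1 + 1 / 2) * (1 + 1 / r)} = 3 / 2 * (1 + 1 / r)"
    by (intro Max_eqI) auto
  moreover have "Max {2, 2, 1 + 1 / 2 :: real} = 2" by simp
  moreover have "\<not> r < 1" "\<not> 3 < r" using assms by auto
  ultimately have "test_prob 2 r = (2 + 1) * (r - 1) / (2 * (3 / 2 * (1 + 1 / r) - 2 + r - 1) + r - 1)"
    unfolding test_prob_def by (simp only: if_False)
  also have "2 * (3 / 2 * (1 + 1 / r) - 2 + r - 1) + r - 1 = (3 * r\<^sup>2 - 4 * r + 3) / r"
    using assms by (simp add: field_simps power2_eq_square)
  finally show ?thesis using assms by simp
qed

lemma test_prob_bounds: "0 \<le> test_prob 2 r" "test_prob 2 r \<le> 1"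
proof -
  have "0 \<le> test_prob 2 r \<and> test_prob 2 r \<le> 1"
  proof (cases "1 \<le> r \<and> r \<le> 3")
    case True
    then have "0 \<le> 3 * r * (r - 1)" by simp
    moreover have "3 * r * (r - 1) \<le> 3 * r\<^sup>2 - 4 * r + 3"
      using True by (simp add: power2_eq_square algebra_simps)
    ultimately show ?thesis
      using True test_prob_denom_pos[of r] by (simp add: test_prob_eq divide_le_eq)
  qed (auto simp: test_prob_def)
  then show "0 \<le> test_prob 2 r" "test_prob 2 r \<le> 1" by auto
qed

text \<open>The maximum of \<open>test_prob 2 r / r\<close>, attained at \<open>r = 1 + sqrt (2 / 3)\<close>, is
  \<open>3 / (2 + 2 * sqrt 6) = 0.43484692\<dots>\<close>.\<close>

lemma test_prob_le:
  assumes "1 \<le> r" "r \<le> 3"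
  shows "test_prob 2 r \<le> 0.43484695 * r"
proof -
  have "3 * (r - 1) \<le> 0.43484695 * (3 * r\<^sup>2 - 4 * r + 3)"
  proof -
    \<comment> \<open>With \<open>c = 0.43484695\<close> the two numbers are \<open>6 * c\<close>
      and \<open>4 * c + 3\<close>, from completing the square in \<open>12 * c\<close> times the
      difference of the two sides. As \<open>c\<close> is rounded up, the discriminant is
      negative.\<close>
    have "0 \<le> (2.6090817 * r - 4.7393878)\<^sup>2" by simp
    then show ?thesis by (simp add: power2_eq_square algebra_simps)
  qed
  then have "r * (3 * (r - 1)) \<le> r * (0.43484695 * (3 * r\<^sup>2 - 4 * r + 3))"
    using assms by (intro mult_left_mono) auto
  then show ?thesis
    using test_prob_denom_pos[of r] by (simp add: test_prob_eq[OF assms] divide_le_eq algebra_simps)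
qed

text \<open>In the worst case an untested job delays by \<open>3 / 2 * u\<close>, and \<open>test_prob\<close> balances the two
  extremes \<open>p = 0\<close> and \<open>p = u\<close>.\<close>

lemma test_prob_balance:
  assumes "1 \<le> r" "r \<le> 3"
  shows "test_prob 2 r * 2 + (1 - test_prob 2 r) * (3 / 2 * r) = 3 / 2 * (1 + test_prob 2 r / r)"
proof -
  define x where "x = test_prob 2 r"
  have "x * (3 * r\<^sup>2 - 4 * r + 3) = 3 * r * (r - 1)"
    using test_prob_denom_pos[of r] by (simp add: x_def test_prob_eq[OF assms])
  then have "4 * (r * x) + 3 * r\<^sup>2 - 3 * r\<^sup>2 * x = 3 * r + 3 * x"
    by (simp add: power2_eq_square algebra_simps)
  then have "2 * r * (x * 2 + (1 - x) * (3 / 2 * r)) = 3 * r + 3 * x"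
    by (simp add: power2_eq_square field_simps)
  also have "\<dots> = 2 * r * (3 / 2 * (1 + x / r))"
    using assms by (simp add: field_simps)
  finally show ?thesis
    using assms unfolding x_def[symmetric] by simp
qed

text \<open>The next two bounds are normalised to \<open>t = 1\<close>; then \<open>r = u\<close>.\<close>

lemma expected_delay_unit:
  fixes r p :: real
  assumes "0 < r" "0 \<le> p" "p \<le> r"
  shows "test_prob 2 r * max (2 + p) (3 / 2 * (1 + p)) + (1 - test_prob 2 r) * (3 / 2 * r)
    \<le> 2.152271 * min r (1 + p)"
proof -
  let ?x = "test_prob 2 r"
  consider "r < 1" | "3 < r" | "1 \<le> r" "r \<le> 3" by linarith
  then show ?thesis
  proof cases
    case 1
    then show ?thesis using assms by (simp add: test_prob_def min_def)
  next
    case 2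
    then show ?thesis using assms by (simp add: test_prob_def min_def max_def)
  next
    case 3
    have x: "0 \<le> ?x" "?x \<le> 1" "?x \<le> 0.43484695 * r"
      using test_prob_bounds test_prob_le[OF 3] by auto
    \<comment> \<open>The extreme \<open>p = 0\<close>. The constant is
      \<open>3 / 2 * 1.43484695\<close>, rounded up.\<close>
    have bal: "?x * 2 + (1 - ?x) * (3 / 2 * r) \<le> 2.152271"
    proof -
      have "?x / r \<le> 0.43484695" using x(3) 3 by (simp add: divide_le_eq)
      then show ?thesis unfolding test_prob_balance[OF 3] by simp
    qed
    have "?x * max (2 + p) (3 / 2 * (1 + p)) + (1 - ?x) * (3 / 2 * r) \<le> 2.152271 * (1 + p)"
    proof -
      have "?x * max (2 + p) (3 / 2 * (1 + p)) \<le> ?x * (2 + 3 / 2 * p)"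
        using x assms by (intro mult_left_mono) auto
      moreover have "?x * p \<le> p" using mult_right_mono[OF x(2) assms(2)] by simp
      ultimately show ?thesis using bal assms(2) by (simp add: algebra_simps)
    qed
    moreover have "?x * max (2 + p) (3 / 2 * (1 + p)) + (1 - ?x) * (3 / 2 * r) \<le> 2.152271 * r"
      if "r \<le> 1 + p"
    proof -
      \<comment> \<open>The extreme \<open>p = r\<close>: here \<open>r \<ge> 1\<close> gives
        \<open>2 + r \<le> 3 / 2 * (1 + r)\<close>.\<close>
      have "?x * max (2 + p) (3 / 2 * (1 + p)) \<le> ?x * (3 / 2 * (1 + r))"
        using x 3 assms by (intro mult_left_mono) (auto simp: max_def)
      moreover have "?x * (3 / 2 * (1 + r)) + (1 - ?x) * (3 / 2 * r) = 3 / 2 * ?x + 3 / 2 * r"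
        by (simp add: field_simps)
      ultimately have "?x * max (2 + p) (3 / 2 * (1 + p)) + (1 - ?x) * (3 / 2 * r) \<le> 3 / 2 * ?x + 3 / 2 * r"
        by linarith
      also have "\<dots> \<le> 2.152271 * r" using x 3 by simp
      finally show ?thesis .
    qed
    ultimately show ?thesis by (simp add: min_def)
  qed
qed

lemma expected_work_unit:
  fixes r p :: real
  assumes "0 < r" "0 \<le> p" "p \<le> r"
  shows "test_prob 2 r * (1 + p) + (1 - test_prob 2 r) * r \<le> 1.434847 * min r (1 + p)"
proof -
  let ?x = "test_prob 2 r"
  consider "r < 1" | "3 < r" | "1 \<le> r" "r \<le> 3" by linarith
  then show ?thesis
  proof cases
    case 1
    then show ?thesis using assms by (simp add: test_prob_def min_def)
  next
    case 2
    then show ?thesis using assms by (simp add: test_prob_def min_def)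
  next
    case 3
    have x: "0 \<le> ?x" "?x \<le> 1" "?x \<le> 0.43484695 * r"
      using test_prob_bounds test_prob_le[OF 3] by auto
    have "?x / r \<le> 0.43484695" using x(3) 3 by (simp add: divide_le_eq)
    then have "?x * 2 + (1 - ?x) * (3 / 2 * r) \<le> 3 / 2 * 1.43484695"
      unfolding test_prob_balance[OF 3] by simp
    \<comment> \<open>A third of this, with \<open>?x \<ge> 0\<close>, bounds
      \<open>?x + r - ?x * r\<close>, the expected work for \<open>p = 0\<close>. For
      \<open>p = r\<close> the expected work is \<open>?x + r\<close>.\<close>
    then have "4 * ?x + 3 * r - 3 * (?x * r) \<le> 3 * 1.43484695"
      by (simp add: field_simps)
    moreover have "?x * p \<le> p" "?x * p \<le> ?x * r"
      using mult_right_mono[OF x(2) assms(2)] mult_left_mono[OF assms(3) x(1)] by simp_all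
    moreover have "?x * (1 + p) + (1 - ?x) * r = ?x + ?x * p + r - ?x * r"
      by (simp add: algebra_simps)
    ultimately have "?x * (1 + p) + (1 - ?x) * r \<le> 1.43484695 + p"
      "?x * (1 + p) + (1 - ?x) * r \<le> 0.43484695 * r + r"
      using x by simp_all
    then have "?x * (1 + p) + (1 - ?x) * r \<le> 1.434847 * (1 + p)"
      "?x * (1 + p) + (1 - ?x) * r \<le> 1.434847 * r"
      using assms by simp_all
    then show ?thesis by (simp add: min_def)
  qed
qed

section \<open>Runs of the algorithm\<close>

definition start_time :: "schedule \<Rightarrow> task \<Rightarrow> real" where
  "start_time S x = snd (the (S x))"

text \<open>Here \<open>rk\<close> records the order in which the tasks were extracted from the queue.
  \<open>queue_weight\<close> holds because each insertion is followed at once by the extraction of a lightest task;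
  so a released execution task that is lighter than some earlier task never waits.\<close>

locale rpcpm_state =
  fixes m :: nat and I :: problem and b :: "nat \<Rightarrow> bool" and rk :: "task \<Rightarrow> nat"
    and Q :: "task set" and R :: "nat \<Rightarrow> (task option \<times> real) option" and S :: schedule
  assumes tasks: "Q \<union> dom S \<subseteq> (\<Union>j<jobs I. tasks b j)"
    and initial_task: "\<And>j. j < jobs I \<Longrightarrow> (if b j then Test j else Untested j) \<in> Q \<union> dom S"
    and disjoint: "Q \<inter> dom S = {}"
    and test_started: "\<And>j. Exec j \<in> Q \<union> dom S \<Longrightarrow> Test j \<in> dom S"
    and queue_weight: "\<And>z y. z \<in> Q \<Longrightarrow> y \<in> dom S \<Longrightarrow> weight 2 I y \<le> weight 2 I z"
    and test_running: "\<And>j. Test j \<in> dom S \<Longrightarrow> Exec j \<notin> Q \<union> dom S \<Longrightarrow> \<exists>i \<tau>. R i = Some (Some (Test j), \<tau>)"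
    and running: "\<And>i x \<tau>. R i = Some (Some x, \<tau>) \<Longrightarrow> \<exists>s. S x = Some (i, s) \<and> \<tau> = s + duration I x"
    and unreleased: "\<And>i j \<tau>. R i = Some (Some (Test j), \<tau>) \<Longrightarrow> Exec j \<notin> Q \<union> dom S"
    and machines: "\<And>i. m \<le> i \<Longrightarrow> R i = None"
    and stopped: "\<And>i. i < m \<Longrightarrow> R i = None \<Longrightarrow> Q = {}"
    and load: "(\<And>i. i < m \<Longrightarrow> R i \<noteq> None) \<Longrightarrow> (\<Sum>i<m. snd (the (R i))) = sum (duration I) (dom S)"
    and rk_less: "\<And>x. x \<in> dom S \<Longrightarrow> rk x < card (dom S)"
    and rk_test: "\<And>j. Exec j \<in> dom S \<Longrightarrow> rk (Test j) < rk (Exec j)"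
    and prompt: "\<And>x. x \<in> dom S \<Longrightarrow>
      (\<exists>j. x = Exec j \<and> start_time S x = start_time S (Test j) + test_time I j) \<or>
      real m * start_time S x \<le> sum (duration I) {y \<in> dom S. rk y < rk x} \<and>
      (\<forall>y\<in>dom S. rk y < rk x \<longrightarrow> weight 2 I y \<le> weight 2 I x)"

lemma rpcpm_state_initial:
  assumes "initial m I b = (Q, R, S)"
  shows "rpcpm_state m I b rk Q R S"
  using assms by unfold_locales (auto simp: initial_def tasks_def split: if_splits)

text \<open>While no machine has stopped, all have been busy without gaps, so the times at which
  they become idle add up to the work started so far; this is \<open>load\<close>. As
  \<open>\<tau>\<close> is the least of these times, \<open>m * \<tau>\<close> is at most that work,
  which yields \<open>prompt\<close> for a task that was waiting in \<open>Q\<close>. A task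
  released in this very step starts at the end of its test, the other alternative of
  \<open>prompt\<close>.\<close>

lemma rpcpm_state_start:
  assumes "rpcpm_state m I b rk Q R S"
    and next_idle: "next_idle R i x \<tau>" and Q': "Q' = Q \<union> released x"
    and y: "y \<in> Q'" "\<forall>z\<in>Q'. weight 2 I y \<le> weight 2 I z"
  shows "rpcpm_state m I b (rk(y := card (dom S))) (Q' - {y}) (R(i \<mapsto> (Some y, \<tau> + duration I y))) (S(y \<mapsto> (i, \<tau>)))"
    (is "rpcpm_state m I b ?rk ?Q ?R ?S")
proof -
  interpret old: rpcpm_state m I b rk Q R S by fact
  have Ri: "R i = Some (x, \<tau>)" and least: "\<And>i' x' \<tau>'. R i' = Some (x', \<tau>') \<Longrightarrow> \<tau> \<le> \<tau>'"
    using next_idle unfolding next_idle_def by blast+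
  have i: "i < m"
    using old.machines[of i] Ri by (cases "i < m") auto
  have released: "\<exists>j. x = Some (Test j) \<and> z = Exec j" if "z \<in> released x" for z
    using that by (cases x rule: released.cases) auto
  have fin: "finite (dom S)"
    by (rule finite_subset[of _ "\<Union>j<jobs I. tasks b j"]) (use old.tasks in auto)
  have new: "z \<notin> Q \<union> dom S" if "z \<in> released x" for z
    using released[OF that] old.unreleased Ri by blast
  have y_new: "y \<notin> dom S"
    using y(1) new old.disjoint unfolding Q' by blast
  have dom: "dom ?S = insert y (dom S)" by auto
  have all: "?Q \<union> dom ?S = Q \<union> released x \<union> dom S"
    using y(1) Q' by auto
  have card: "card (dom ?S) = Suc (card (dom S))"
    unfolding dom using fin y_new by simp
  have x_run: "\<exists>s. S z = Some (i, s) \<and> \<tau> = s + duration I z" if "x = Some z" for z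
    using old.running Ri that by blast
  have x_dom: "Test j \<in> dom S" if "x = Some (Test j)" for j
    using x_run[OF that] by blast
  have before: "{z \<in> dom ?S. ?rk z < ?rk u} = {z \<in> dom S. rk z < rk u}" if "u \<in> dom S" for u
    using old.rk_less[OF that] that y_new by (auto simp: dom)
  have before_y: "{z \<in> dom ?S. ?rk z < ?rk y} = dom S"
    using old.rk_less y_new by (auto simp: dom)
  show ?thesis
  proof
    show "?Q \<union> dom ?S \<subseteq> (\<Union>j<jobs I. tasks b j)"
    proof -
      have "z \<in> (\<Union>j<jobs I. tasks b j)" if "z \<in> released x" for z
      proof -
        obtain j where j: "x = Some (Test j)" "z = Exec j" using released[OF \<open>z \<in> released x\<close>] by blast
        have "Test j \<in> (\<Union>j<jobs I. tasks b j)" using x_dom[OF j(1)] old.tasks by blast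
        then show ?thesis unfolding j(2) by (auto simp: tasks_def split: if_splits)
      qed
      then have "released x \<subseteq> (\<Union>j<jobs I. tasks b j)" by (rule subsetI)
      with old.tasks show ?thesis unfolding all by simp
    qed
    show "(if b j then Test j else Untested j) \<in> ?Q \<union> dom ?S" if "j < jobs I" for j
      unfolding all using old.initial_task[OF that] by blast
    show "?Q \<inter> dom ?S = {}"
      unfolding dom Q' using new old.disjoint by blast
    show "Test j \<in> dom ?S" if "Exec j \<in> ?Q \<union> dom ?S" for j
      using that old.test_started[of j] released[of "Exec j"] x_dom unfolding all by auto
    show "weight 2 I u \<le> weight 2 I z" if "z \<in> ?Q" "u \<in> dom ?S" for z u
    proof (cases "u = y")
      case True
      then show ?thesis using that y by blast
    next
      case False
      then have u: "u \<in> dom S" using that dom by blast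
      show ?thesis
      proof (cases "z \<in> Q")
        \<comment> \<open>Only one task is released, so if \<open>z\<close> is new then
          \<open>y\<close> was waiting in \<open>Q\<close>: it is at least as heavy as all tasks
          started before, and \<open>z\<close> is no lighter than \<open>y\<close>.\<close>
        case False
        then have "z \<in> released x" using that Q' by blast
        then have "y \<in> Q" using that released[of z] released[of y] y(1) Q' by auto
        then show ?thesis using old.queue_weight[OF _ u] y(2) that by force
      qed (use u old.queue_weight in blast)
    qed
    show "\<exists>i \<tau>. ?R i = Some (Some (Test j), \<tau>)" if "Test j \<in> dom ?S" "Exec j \<notin> ?Q \<union> dom ?S" for j
    proof (cases "y = Test j")
      case False
      then have "Test j \<in> dom S" "Exec j \<notin> Q \<union> dom S" "x \<noteq> Some (Test j)"
        using that unfolding all by auto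
      then obtain i' \<tau>' where "R i' = Some (Some (Test j), \<tau>')" "i' \<noteq> i"
        using old.test_running[of j] Ri by fastforce
      then show ?thesis by auto
    qed auto
    show "\<exists>s. ?S u = Some (i', s) \<and> \<tau>' = s + duration I u" if "?R i' = Some (Some u, \<tau>')" for i' u \<tau>'
    proof (cases "i' = i")
      case False
      then have "R i' = Some (Some u, \<tau>')" using that by simp
      then show ?thesis using old.running[of i' u \<tau>'] y_new by (auto simp: domIff)
    qed (use that in auto)
    show "Exec j \<notin> ?Q \<union> dom ?S" if r: "?R i' = Some (Some (Test j), \<tau>')" for i' j \<tau>'
    proof (cases "i' = i")
      case True
      then have "y = Test j" using r by simp
      then show ?thesis
        using old.test_started[of j] y_new released[of "Exec j"] x_dom unfolding all by blast
    next
      case False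
      then have r: "R i' = Some (Some (Test j), \<tau>')" using r by simp
      \<comment> \<open>A test runs on one machine only: \<open>S\<close> assigns it either to
        \<open>i\<close> or to \<open>i'\<close>.\<close>
      then have "x \<noteq> Some (Test j)"
        using old.running[OF r] x_run[of "Test j"] False by auto
      then show ?thesis
        using old.unreleased[OF r] released[of "Exec j"] unfolding all by blast
    qed
    show "?R i' = None" if "m \<le> i'" for i'
      using old.machines[OF that] that i by auto
    show "?Q = {}" if "i' < m" "?R i' = None" for i'
    proof -
      \<comment> \<open>After a machine has stopped, a step can only extract the task that it has
        just released, so nothing is left over.\<close>
      have "Q = {}" using old.stopped[OF that(1)] that(2) by (simp split: if_splits)
      then show ?thesis using y(1) released[of y] released Q' by blast
    qed
    show "(\<Sum>i<m. snd (the (?R i))) = sum (duration I) (dom ?S)" if "\<And>i'. i' < m \<Longrightarrow> ?R i' \<noteq> None"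
    proof -
      have "R i' \<noteq> None" if "i' < m" for i'
        using \<open>\<And>i'. i' < m \<Longrightarrow> ?R i' \<noteq> None\<close>[OF that] Ri by (cases "i' = i") auto
      then have "(\<Sum>i<m. snd (the (R i))) = sum (duration I) (dom S)" by (rule old.load)
      moreover have "(\<Sum>i<m. snd (the (?R i))) = (\<Sum>i'<m. snd (the (R i')) + (if i' = i then duration I y else 0))"
        using Ri by (intro sum.cong) auto
      ultimately show ?thesis
        using i fin y_new unfolding dom by (simp add: sum.distrib)
    qed
    show "?rk u < card (dom ?S)" if "u \<in> dom ?S" for u
      using that old.rk_less[of u] unfolding card by (cases "u = y") (auto simp: less_Suc_eq)
    show "?rk (Test j) < ?rk (Exec j)" if "Exec j \<in> dom ?S" for j
    proof (cases "y = Exec j")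
      case True
      then have "Test j \<in> dom S"
        using y(1) released[of y] old.test_started[of j] x_dom unfolding Q' by blast
      then show ?thesis using True old.rk_less by auto
    next
      case False
      then have "Exec j \<in> dom S" using that by simp
      then show ?thesis using old.rk_test[of j] old.test_started[of j] y_new False by auto
    qed
    show "(\<exists>j. u = Exec j \<and> start_time ?S u = start_time ?S (Test j) + test_time I j) \<or>
      real m * start_time ?S u \<le> sum (duration I) {z \<in> dom ?S. ?rk z < ?rk u} \<and>
      (\<forall>z\<in>dom ?S. ?rk z < ?rk u \<longrightarrow> weight 2 I z \<le> weight 2 I u)" if "u \<in> dom ?S" for u
    proof (cases "u = y")
      case False
      then have u: "u \<in> dom S" using that dom by blast
      have st: "start_time ?S z = start_time S z" if "z \<in> dom S" for z
        using that y_new by (auto simp: start_time_def)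
      have less: "z \<in> dom S \<and> rk z < rk u" if "z \<in> dom ?S" "?rk z < ?rk u" for z
        using that before[OF u] by blast
      from old.prompt[OF u] show ?thesis
      proof (elim disjE exE conjE)
        fix j assume j: "u = Exec j" "start_time S u = start_time S (Test j) + test_time I j"
        have "start_time ?S u = start_time ?S (Test j) + test_time I j"
          using old.test_started[of j] u j st by simp
        with j(1) show ?thesis by blast
      next
        assume "real m * start_time S u \<le> sum (duration I) {z \<in> dom S. rk z < rk u}"
          and "\<forall>z\<in>dom S. rk z < rk u \<longrightarrow> weight 2 I z \<le> weight 2 I u"
        then show ?thesis
          unfolding before[OF u] st[OF u] using less by blast
      qed
    next
      case True
      show ?thesis
      proof (cases "y \<in> Q")
        case True
        then have active: "\<And>i'. i' < m \<Longrightarrow> R i' \<noteq> None" using old.stopped by blast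
        have "real m * \<tau> = (\<Sum>i'<m. \<tau>)" by simp
        also have "\<dots> \<le> (\<Sum>i'<m. snd (the (R i')))"
        proof (rule sum_mono)
          fix i' assume "i' \<in> {..<m}"
          then obtain x' \<tau>' where "R i' = Some (x', \<tau>')" using active[of i'] by fastforce
          then show "\<tau> \<le> snd (the (R i'))" using least by auto
        qed
        also have "\<dots> = sum (duration I) (dom S)" using active by (rule old.load)
        finally have "real m * start_time ?S y \<le> sum (duration I) (dom S)" by (simp add: start_time_def)
        moreover have "weight 2 I z \<le> weight 2 I y" if "z \<in> dom S" for z
          using old.queue_weight[OF True that] .
        ultimately show ?thesis
          unfolding \<open>u = y\<close> before_y using before_y by blast
      next
        case False
        then obtain j where "x = Some (Test j)" "y = Exec j"
          using y(1) released[of y] Q' by blast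
        then show ?thesis
          using x_run[of "Test j"] by (auto simp: start_time_def \<open>u = y\<close>)
      qed
    qed
  qed
qed

text \<open>The stopping machine has not just finished a test, since \<open>released x\<close> is
  empty; so no running test is lost. The premise of \<open>load\<close> becomes false.\<close>

lemma rpcpm_state_stop:
  assumes "rpcpm_state m I b rk Q R S" and "next_idle R i x \<tau>" and empty: "Q \<union> released x = {}"
  shows "rpcpm_state m I b rk Q (R(i := None)) S"
proof -
  interpret old: rpcpm_state m I b rk Q R S by fact
  have Ri: "R i = Some (x, \<tau>)" using assms(2) by (simp add: next_idle_def)
  then have i: "i < m"
    using old.machines[of i] by (cases "i < m") auto
  show ?thesis
  proof
    show "\<exists>i' \<tau>. (R(i := None)) i' = Some (Some (Test j), \<tau>)"
      if j: "Test j \<in> dom S" "Exec j \<notin> Q \<union> dom S" for j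
    proof -
      obtain i' \<tau>' where r: "R i' = Some (Some (Test j), \<tau>')"
        using old.test_running[OF j] by blast
      moreover have "i' \<noteq> i" using r Ri empty by auto
      ultimately show ?thesis by auto
    qed
    show "(\<Sum>i'<m. snd (the ((R(i := None)) i'))) = sum (duration I) (dom S)"
      if "\<And>i'. i' < m \<Longrightarrow> (R(i := None)) i' \<noteq> None"
      using that[OF i] by simp
    show "Q = {}" using empty by simp
    show "weight 2 I y \<le> weight 2 I z" if "z \<in> Q" "y \<in> dom S" for z y
      using that by (rule old.queue_weight)
    show "\<exists>s. S u = Some (i', s) \<and> \<tau>' = s + duration I u" if "(R(i := None)) i' = Some (Some u, \<tau>')" for i' u \<tau>'
      using that old.running[of i' u \<tau>'] by (simp split: if_splits)
    show "Exec j \<notin> Q \<union> dom S" if "(R(i := None)) i' = Some (Some (Test j), \<tau>')" for i' j \<tau>'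
      using that old.unreleased[of i' j \<tau>'] by (simp split: if_splits)
    show "(R(i := None)) i' = None" if "m \<le> i'" for i'
      using old.machines[OF that] by simp
  qed (fact old.tasks old.initial_task old.disjoint old.test_started old.rk_less old.rk_test old.prompt)+
qed

text \<open>The order \<open>rk\<close> is not part of the state, so the invariant is carried along
  as an existence statement. At the end machine 0 has stopped, hence the queue is empty, and no test
  is running, hence every tested job has been executed.\<close>

lemma rpcpm_run_final:
  assumes "rpcpm_run 2 m I b S" "1 \<le> m"
  obtains rk where "rpcpm_state m I b rk {} Map.empty S" "dom S = (\<Union>j<jobs I. tasks b j)"
proof -
  obtain Q where Q: "(rpcpm_step 2 I)\<^sup>*\<^sup>* (initial m I b) (Q, Map.empty, S)"
    using assms(1) unfolding rpcpm_run_def by blast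
  have "\<forall>Q R S. (rpcpm_step 2 I)\<^sup>*\<^sup>* (initial m I b) (Q, R, S) \<longrightarrow> (\<exists>rk. rpcpm_state m I b rk Q R S)"
  proof -
    have "\<forall>Q R S. s = (Q, R, S) \<longrightarrow> (\<exists>rk. rpcpm_state m I b rk Q R S)"
      if "(rpcpm_step 2 I)\<^sup>*\<^sup>* (initial m I b) s" for s
      using that
    proof (induction rule: rtranclp_induct)
      case base
      then show ?case by (intro allI impI exI rpcpm_state_initial)
    next
      case (step s s')
      from step.hyps(2) show ?case
      proof cases
        case (start R i x \<tau> Q' Q y S)
        then obtain rk where "rpcpm_state m I b rk Q R S" using step.IH by blast
        from rpcpm_state_start[OF this start(3-6)] show ?thesis using start(2) by blast
      next
        case (stop R i x \<tau> Q S)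
        then obtain rk where "rpcpm_state m I b rk Q R S" using step.IH by blast
        from rpcpm_state_stop[OF this stop(3,4)] show ?thesis using stop(2) by blast
      qed
    qed
    then show ?thesis by blast
  qed
  with Q obtain rk where rk: "rpcpm_state m I b rk Q Map.empty S" by blast
  then interpret rpcpm_state m I b rk Q Map.empty S .
  have "Q = {}" using stopped[of 0] assms(2) by simp
  have "tasks b j \<subseteq> dom S" if "j < jobs I" for j
    using initial_task[OF that] test_running[of j] unfolding \<open>Q = {}\<close>
    by (cases "b j") (auto simp: tasks_def)
  then have "dom S = (\<Union>j<jobs I. tasks b j)"
    using tasks by blast
  with rk show ?thesis
    unfolding \<open>Q = {}\<close> by (rule that)
qed

section \<open>Mutual delays of jobs in a finished run\<close>

text \<open>Bounds the mutual delay of \<open>j\<close> and any other job through the coin flip of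
  \<open>j\<close> alone; \<open>mutual_delay_le\<close> shows where the three terms come
  from.\<close>

definition delay_bound :: "problem \<Rightarrow> (nat \<Rightarrow> bool) \<Rightarrow> nat \<Rightarrow> real" where
  "delay_bound I b j = (if b j
     then max (2 * test_time I j + proc I j) (3 / 2 * (test_time I j + proc I j))
     else 3 / 2 * upper I j)"

text \<open>The task before whose start all machines are busy and that only tasks of at most its own
  weight precede: an execution task that follows its test immediately is charged to the test.\<close>

definition key_task :: "problem \<Rightarrow> (nat \<Rightarrow> bool) \<Rightarrow> schedule \<Rightarrow> nat \<Rightarrow> task" where
  "key_task I b S j = (if \<not> b j then Untested j
     else if start_time S (Exec j) = start_time S (Test j) + test_time I j then Test j else Exec j)"

text \<open>The diagonal \<open>i = j\<close> is included: in a finished run it is the testing time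
  of \<open>j\<close> if the key task is the execution, and 0 otherwise.\<close>

definition delay :: "problem \<Rightarrow> (nat \<Rightarrow> bool) \<Rightarrow> (task \<Rightarrow> nat) \<Rightarrow> schedule \<Rightarrow> nat \<Rightarrow> nat \<Rightarrow> real" where
  "delay I b rk S i j = (\<Sum>x\<in>tasks b i. if rk x < rk (key_task I b S j) then duration I x else 0)"

context
  fixes m I b rk S
  assumes I: "valid I"
    and final: "rpcpm_state m I b rk {} Map.empty S"
    and dom: "dom S = (\<Union>j<jobs I. tasks b j)"
    and m: "1 \<le> m"
begin

interpretation rpcpm_state m I b rk "{}" Map.empty S
  by (fact final)

abbreviation "key \<equiv> key_task I b S"

lemma key_in: "key j \<in> tasks b j"
  by (simp add: key_task_def tasks_def)

lemma tasks_dom: "j < jobs I \<Longrightarrow> x \<in> tasks b j \<Longrightarrow> x \<in> dom S"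
  unfolding dom by blast

lemma key_prompt:
  assumes j: "j < jobs I"
  shows "real m * start_time S (key j) \<le> sum (duration I) {y \<in> dom S. rk y < rk (key j)}"
    and "\<And>y. y \<in> dom S \<Longrightarrow> rk y < rk (key j) \<Longrightarrow> weight 2 I y \<le> weight 2 I (key j)"
proof -
  have "\<not> (\<exists>i. key j = Exec i \<and> start_time S (key j) = start_time S (Test i) + test_time I i)"
    by (auto simp: key_task_def split: if_splits)
  then show "real m * start_time S (key j) \<le> sum (duration I) {y \<in> dom S. rk y < rk (key j)}"
    and "\<And>y. y \<in> dom S \<Longrightarrow> rk y < rk (key j) \<Longrightarrow> weight 2 I y \<le> weight 2 I (key j)"
    using prompt[OF tasks_dom[OF j key_in]] by blast+
qed

lemma work_before_key:
  assumes j: "j < jobs I"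
  shows "sum (duration I) {y \<in> dom S. rk y < rk (key j)}
    = (\<Sum>i\<in>{..<jobs I} - {j}. delay I b rk S i j) + delay I b rk S j j"
proof -
  have "finite (dom S)" by (simp add: dom)
  then have "sum (duration I) {y \<in> dom S. rk y < rk (key j)}
      = (\<Sum>x\<in>dom S. if rk x < rk (key j) then duration I x else 0)"
    by (rule sum.inter_filter)
  also have "\<dots> = (\<Sum>i<jobs I. delay I b rk S i j)"
    unfolding dom sum_tasks delay_def ..
  also have "\<dots> = (\<Sum>i\<in>{..<jobs I} - {j}. delay I b rk S i j) + delay I b rk S j j"
    using j by (simp add: sum.remove[of "{..<jobs I}" j] add.commute)
  finally show ?thesis .
qed

lemma completion_le_delays:
  assumes j: "j < jobs I"
  shows "real m * completion I S j \<le> (\<Sum>i\<in>{..<jobs I} - {j}. delay I b rk S i j) + real m * work I b j"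
proof -
  note [simp] = validD[OF I j]
  have comp: "completion I S j = (if b j then start_time S (Exec j) + proc I j
      else start_time S (Untested j) + upper I j)"
  proof -
    have "Untested j \<in> dom S \<longleftrightarrow> \<not> b j"
      using j by (auto simp: dom tasks_def split: if_splits)
    then show ?thesis by (simp add: completion_def start_time_def)
  qed
  \<comment> \<open>If the key task is the execution, the job's own test is part of the work before
    it. This \<open>delay I b rk S j j\<close> is at most \<open>m\<close> times the testing time,
    which the term \<open>m * work\<close> on the right contains.\<close>
  have "real m * completion I S j + delay I b rk S j j \<le> real m * start_time S (key j) + real m * work I b j"
  proof (cases "b j")
    case True
    have "rk (Test j) < rk (Exec j)"
      using True j by (intro rk_test) (auto simp: dom tasks_def)
    moreover have "test_time I j \<le> real m * test_time I j"
      using m by simp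
    ultimately show ?thesis
      using True by (auto simp: comp key_task_def work_def delay_def tasks_def algebra_simps)
  next
    case False
    then show ?thesis
      by (simp add: comp key_task_def work_def delay_def tasks_def algebra_simps)
  qed
  then show ?thesis
    using key_prompt(1)[OF j] unfolding work_before_key[OF j] by linarith
qed

text \<open>Let \<open>t\<close>, \<open>p\<close>, \<open>u\<close> belong to \<open>i\<close>.
  Tasks of \<open>j\<close> ahead of \<open>key i\<close> weigh at most as much as
  \<open>key i\<close>. If all of \<open>j\<close> is ahead, the execution of \<open>i\<close>
  cannot delay \<open>j\<close>, and the sum is at most \<open>2 * t + p\<close> or
  \<open>u\<close>. If only the test of \<open>j\<close> is ahead, its length is at most half the
  weight of \<open>key i\<close>, because \<open>\<beta> = 2\<close>; so at most \<open>t\<close>,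
  \<open>(t + p) / 2\<close> or \<open>u / 2\<close> is added to the full work of
  \<open>i\<close>.\<close>

lemma mutual_delay_le:
  assumes i: "i < jobs I" and j: "j < jobs I"
  shows "delay I b rk S i j + delay I b rk S j i \<le> delay_bound I b i"
proof -
  note pos = validD[OF I i] validD[OF I j]
  have rk: "rk (Test k) < rk (Exec k)" if "b k" "k < jobs I" for k
    using that by (intro rk_test) (auto simp: dom tasks_def)
  have d: "x \<in> dom S" if "x \<in> tasks b i \<or> x \<in> tasks b j" for x
    using that i j tasks_dom by blast
  have wi: "weight 2 I x \<le> weight 2 I (key i)" if "x \<in> tasks b j" "rk x < rk (key i)" for x
    using key_prompt(2)[OF i] d that by blast
  show ?thesis
  proof (cases "b i"; cases "b j")
    assume b: "b i" "b j"
    have delays: "delay I b rk S i j = (if rk (Test i) < rk (key j) then test_time I i else 0)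
        + (if rk (Exec i) < rk (key j) then proc I i else 0)"
      "delay I b rk S j i = (if rk (Test j) < rk (key i) then test_time I j else 0)
        + (if rk (Exec j) < rk (key i) then proc I j else 0)"
      using b by (simp_all add: delay_def tasks_def)
    have G: "2 * test_time I i + proc I i \<le> delay_bound I b i"
      "3 / 2 * (test_time I i + proc I i) \<le> delay_bound I b i"
      using b by (simp_all add: delay_bound_def)
    have ki: "key i = Test i \<or> key i = Exec i" and kj: "rk (key j) \<le> rk (Exec j)"
      using b rk[OF b(1) i] rk[OF b(2) j] by (auto simp: key_task_def)
    show ?thesis
    proof (cases "rk (Exec j) < rk (key i)")
      case True
      then have "\<not> rk (Exec i) < rk (key j)"
        using ki kj rk[OF b(1) i] by auto
      moreover have "\<not> rk (Test i) < rk (key j)" if "key i = Test i"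
        using True kj that by simp
      moreover have "test_time I j + proc I j \<le> weight 2 I (key i)"
        using wi[of "Exec j"] True b by (simp add: tasks_def)
      ultimately show ?thesis
        using pos ki G unfolding delays by (elim disjE) auto
    next
      case False
      moreover have "2 * test_time I j \<le> weight 2 I (key i)" if "rk (Test j) < rk (key i)"
        using wi[of "Test j"] that b by (simp add: tasks_def)
      ultimately show ?thesis
        using pos ki G unfolding delays by (elim disjE) auto
    qed
  next
    assume b: "b i" "\<not> b j"
    have delays: "delay I b rk S i j = (if rk (Test i) < rk (Untested j) then test_time I i else 0)
        + (if rk (Exec i) < rk (Untested j) then proc I i else 0)"
      "delay I b rk S j i = (if rk (Untested j) < rk (key i) then upper I j else 0)"
      using b by (simp_all add: delay_def tasks_def key_task_def)
    have G: "2 * test_time I i + proc I i \<le> delay_bound I b i"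
      using b by (simp add: delay_bound_def)
    have ki: "key i = Test i \<or> key i = Exec i"
      using b by (simp add: key_task_def)
    show ?thesis
    proof (cases "rk (Untested j) < rk (key i)")
      case True
      then have "\<not> rk (Exec i) < rk (Untested j)"
        using ki rk[OF b(1) i] by auto
      moreover have "upper I j \<le> weight 2 I (key i)"
        using wi[of "Untested j"] True b by (simp add: tasks_def)
      ultimately show ?thesis
        using pos ki G True unfolding delays by (elim disjE) auto
    qed (use pos G in \<open>auto simp: delays\<close>)
  next
    assume b: "\<not> b i" "b j"
    have delays: "delay I b rk S i j = (if rk (Untested i) < rk (key j) then upper I i else 0)"
      "delay I b rk S j i = (if rk (Test j) < rk (Untested i) then test_time I j else 0)
        + (if rk (Exec j) < rk (Untested i) then proc I j else 0)"
      using b by (simp_all add: delay_def tasks_def key_task_def)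
    have G: "delay_bound I b i = 3 / 2 * upper I i" and ki: "key i = Untested i"
      using b by (simp_all add: delay_bound_def key_task_def)
    have kj: "rk (key j) \<le> rk (Exec j)"
      using b rk[OF b(2) j] by (auto simp: key_task_def)
    show ?thesis
    proof (cases "rk (Exec j) < rk (Untested i)")
      case True
      then show ?thesis
        using pos wi[of "Exec j"] b kj unfolding delays G ki by (auto simp: tasks_def)
    next
      case False
      then show ?thesis
        using pos wi[of "Test j"] b unfolding delays G ki by (auto simp: tasks_def)
    qed
  next
    assume b: "\<not> b i" "\<not> b j"
    have delays: "delay I b rk S i j = (if rk (Untested i) < rk (Untested j) then upper I i else 0)"
      "delay I b rk S j i = (if rk (Untested j) < rk (Untested i) then upper I j else 0)"
      using b by (simp_all add: delay_def tasks_def key_task_def)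
    have G: "delay_bound I b i = 3 / 2 * upper I i" and ki: "key i = Untested i"
      using b by (simp_all add: delay_bound_def key_task_def)
    show ?thesis
      using pos wi[of "Untested j"] b unfolding delays G ki by (auto simp: tasks_def)
  qed
qed

text \<open>The delays over ordered pairs are half the sum of the mutual delays. Since
  \<open>mutual_delay_le\<close> applies to either job of a pair, the minimum of both bounds is
  available.\<close>

lemma cost_le_delay_bounds:
  "real m * cost I S \<le> (\<Sum>i<jobs I. \<Sum>j\<in>{..<jobs I} - {i}. min (delay_bound I b i) (delay_bound I b j)) / 2
    + real m * (\<Sum>j<jobs I. work I b j)"
proof -
  let ?n = "jobs I" and ?d = "delay I b rk S"
  have swap: "(\<Sum>j<?n. \<Sum>i\<in>{..<?n} - {j}. ?d i j) = (\<Sum>j<?n. \<Sum>i\<in>{..<?n} - {j}. ?d j i)"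
  proof -
    have eq: "(\<Sum>j<?n. \<Sum>i\<in>{..<?n} - {j}. f i j) = (\<Sum>j<?n. \<Sum>i<?n. if i \<noteq> j then f i j else 0)"
      for f :: "nat \<Rightarrow> nat \<Rightarrow> real"
      by (intro sum.cong refl sum.mono_neutral_cong_left) auto
    have "(\<Sum>j<?n. \<Sum>i<?n. if i \<noteq> j then ?d i j else 0) = (\<Sum>i<?n. \<Sum>j<?n. if j \<noteq> i then ?d i j else 0)"
      by (subst sum.swap) (simp add: eq_commute)
    then show ?thesis unfolding eq .
  qed
  have "real m * cost I S \<le> (\<Sum>j<?n. (\<Sum>i\<in>{..<?n} - {j}. ?d i j) + real m * work I b j)"
    unfolding cost_def sum_distrib_left by (intro sum_mono completion_le_delays) auto
  also have "\<dots> = (\<Sum>j<?n. \<Sum>i\<in>{..<?n} - {j}. ?d i j) + real m * (\<Sum>j<?n. work I b j)"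
    by (simp add: sum.distrib sum_distrib_left)
  also have "(\<Sum>j<?n. \<Sum>i\<in>{..<?n} - {j}. ?d i j) = (\<Sum>j<?n. \<Sum>i\<in>{..<?n} - {j}. ?d j i + ?d i j) / 2"
    using swap by (simp add: sum.distrib)
  also have "\<dots> \<le> (\<Sum>j<?n. \<Sum>i\<in>{..<?n} - {j}. min (delay_bound I b j) (delay_bound I b i)) / 2"
  proof (intro divide_right_mono sum_mono min.boundedI)
    fix i j assume "j \<in> {..<?n}" "i \<in> {..<?n} - {j}"
    then show "?d j i + ?d i j \<le> delay_bound I b j" "?d j i + ?d i j \<le> delay_bound I b i"
      using mutual_delay_le[of i j] mutual_delay_le[of j i] by simp_all
  qed simp
  finally show ?thesis by simp
qed

end

lemma rpcpm_run_cost_le: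
  assumes "valid I" "rpcpm_run 2 m I b S" "1 \<le> m"
  shows "real m * cost I S \<le>
    (\<Sum>i<jobs I. \<Sum>j\<in>{..<jobs I} - {i}. min (delay_bound I b i) (delay_bound I b j)) / 2
    + real m * (\<Sum>j<jobs I. work I b j)"
proof -
  obtain rk where "rpcpm_state m I b rk {} Map.empty S" "dom S = (\<Union>j<jobs I. tasks b j)"
    using assms(2,3) by (rule rpcpm_run_final)
  then show ?thesis
    by (rule cost_le_delay_bounds[OF assms(1) _ _ assms(3)])
qed

section \<open>The expected cost\<close>

abbreviation coins :: "problem \<Rightarrow> (nat \<Rightarrow> bool) pmf" where
  "coins I \<equiv> Pi_pmf {..<jobs I} False (\<lambda>j. bernoulli_pmf (test_prob 2 (upper I j / test_time I j)))"

lemma integrable_coins [simp]: "integrable (coins I) (f :: _ \<Rightarrow> real)"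
proof (rule integrable_measure_pmf_finite)
  show "finite (set_pmf (coins I))"
    by (simp add: set_Pi_pmf finite_PiE_dflt)
qed

lemma expectation_coin:
  fixes g :: "bool \<Rightarrow> real"
  assumes "j < jobs I"
  defines "x \<equiv> test_prob 2 (upper I j / test_time I j)"
  shows "measure_pmf.expectation (coins I) (\<lambda>b. g (b j)) = x * g True + (1 - x) * g False"
proof -
  have "measure_pmf.expectation (coins I) (\<lambda>b. g (b j))
      = measure_pmf.expectation (map_pmf (\<lambda>b. b j) (coins I)) g"
    by simp
  also have "map_pmf (\<lambda>b. b j) (coins I) = bernoulli_pmf x"
    using assms by (simp add: Pi_pmf_component)
  finally show ?thesis
    using test_prob_bounds by (simp add: x_def mult.commute)
qed

text \<open>Only one coin matters, and division by the testing time leads to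
  \<open>expected_delay_unit\<close>.\<close>

lemma expectation_delay_bound_le:
  assumes I: "valid I" and j: "j < jobs I"
  shows "measure_pmf.expectation (coins I) (\<lambda>b. delay_bound I b j) \<le> 2.152271 * min_work I j"
proof -
  define t u p x where "t = test_time I j" and "u = upper I j" and "p = proc I j"
    and "x = test_prob 2 (upper I j / test_time I j)"
  have pos: "0 < t" "0 < u" "0 \<le> p" "p \<le> u"
    using validD[OF I j] by (simp_all add: t_def u_def p_def)
  have "measure_pmf.expectation (coins I) (\<lambda>b. delay_bound I b j)
      = x * max (2 * t + p) (3 / 2 * (t + p)) + (1 - x) * (3 / 2 * u)"
    using expectation_coin[OF j, of "\<lambda>c. if c then max (2 * t + p) (3 / 2 * (t + p)) else 3 / 2 * u"]
    by (simp only: delay_bound_def t_def u_def p_def x_def if_True if_False)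
  also have "\<dots> = t * (x * max (2 + p / t) (3 / 2 * (1 + p / t)) + (1 - x) * (3 / 2 * (u / t)))"
  proof -
    have "t * max (2 + p / t) (3 / 2 * (1 + p / t)) = max (2 * t + p) (3 / 2 * (t + p))"
    proof -
      have "t * (2 + p / t) = 2 * t + p" "t * (3 / 2 * (1 + p / t)) = 3 / 2 * (t + p)"
        using pos by (simp_all add: field_simps)
      then show ?thesis
        using pos by (simp only: max_mult_distrib_left less_imp_le if_True)
    qed
    then show ?thesis using pos by (simp add: distrib_left mult.left_commute[of t x])
  qed
  also have "\<dots> \<le> t * (2.152271 * min (u / t) (1 + p / t))"
    unfolding x_def t_def[symmetric] u_def[symmetric] using pos
    by (intro mult_left_mono expected_delay_unit) (auto simp: divide_right_mono)
  also have "\<dots> = 2.152271 * (t * min (u / t) (1 + p / t))"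
    by simp
  also have "t * min (u / t) (1 + p / t) = min_work I j"
    using pos unfolding min_work_def t_def[symmetric] u_def[symmetric] p_def[symmetric]
    by (simp add: min_mult_distrib_left distrib_left)
  finally show ?thesis .
qed

lemma expectation_work_le:
  assumes I: "valid I" and j: "j < jobs I"
  shows "measure_pmf.expectation (coins I) (\<lambda>b. work I b j) \<le> 1.434847 * min_work I j"
proof -
  define t u p x where "t = test_time I j" and "u = upper I j" and "p = proc I j"
    and "x = test_prob 2 (upper I j / test_time I j)"
  have pos: "0 < t" "0 < u" "0 \<le> p" "p \<le> u"
    using validD[OF I j] by (simp_all add: t_def u_def p_def)
  have "measure_pmf.expectation (coins I) (\<lambda>b. work I b j) = x * (t + p) + (1 - x) * u"
    using expectation_coin[OF j, of "\<lambda>c. if c then t + p else u"]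
    by (simp only: work_def t_def u_def p_def x_def if_True if_False)
  also have "\<dots> = t * (x * (1 + p / t) + (1 - x) * (u / t))"
    using pos by (simp add: field_simps)
  also have "\<dots> \<le> t * (1.434847 * min (u / t) (1 + p / t))"
    unfolding x_def t_def[symmetric] u_def[symmetric] using pos
    by (intro mult_left_mono expected_work_unit) (auto simp: divide_right_mono)
  also have "\<dots> = 1.434847 * (t * min (u / t) (1 + p / t))"
    by simp
  also have "t * min (u / t) (1 + p / t) = min_work I j"
    using pos unfolding min_work_def t_def[symmetric] u_def[symmetric] p_def[symmetric]
    by (simp add: min_mult_distrib_left distrib_left)
  finally show ?thesis .
qed

text \<open>The cost bound holds for each outcome \<open>b\<close> separately, so ties may be broken
  differently for different flips. The expectation of a minimum is at most either expectation, and
  \<open>P - W\<close> is the sum over distinct jobs because the diagonal of \<open>P\<close> is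
  \<open>W\<close>.\<close>

lemma expected_cost_le:
  assumes I: "valid I" and run: "\<And>b. rpcpm_run 2 m I b (\<sigma> b)" and m: "1 \<le> m"
  defines "P \<equiv> (\<Sum>i<jobs I. \<Sum>j<jobs I. min (min_work I i) (min_work I j))"
    and "W \<equiv> (\<Sum>j<jobs I. min_work I j)"
  shows "2 * real m * expected_cost (test_prob 2) I \<sigma> \<le> 2.152271 * (P - W) + 2 * real m * 1.434847 * W"
proof -
  let ?n = "jobs I" and ?E = "measure_pmf.expectation (coins I)"
  let ?g = "delay_bound I"
  have "real m * expected_cost (test_prob 2) I \<sigma> = ?E (\<lambda>b. real m * cost I (\<sigma> b))"
    by (simp add: expected_cost_def)
  also have "\<dots> \<le> ?E (\<lambda>b. (\<Sum>i<?n. \<Sum>j\<in>{..<?n} - {i}. min (?g b i) (?g b j)) / 2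
      + real m * (\<Sum>j<?n. work I b j))"
    using rpcpm_run_cost_le[OF I run m] by (intro integral_mono) auto
  also have "\<dots> = (\<Sum>i<?n. \<Sum>j\<in>{..<?n} - {i}. ?E (\<lambda>b. min (?g b i) (?g b j))) / 2
      + real m * (\<Sum>j<?n. ?E (\<lambda>b. work I b j))"
    by simp
  also have "\<dots> \<le> (\<Sum>i<?n. \<Sum>j\<in>{..<?n} - {i}. 2.152271 * min (min_work I i) (min_work I j)) / 2
      + real m * (\<Sum>j<?n. 1.434847 * min_work I j)"
  proof (intro add_mono divide_right_mono mult_left_mono sum_mono)
    fix i j assume ij: "i \<in> {..<?n}" "j \<in> {..<?n} - {i}"
    have "?E (\<lambda>b. min (?g b i) (?g b j)) \<le> ?E (\<lambda>b. ?g b k)" if "k = i \<or> k = j" for k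
      using that by (intro integral_mono) auto
    moreover have "?E (\<lambda>b. ?g b k) \<le> 2.152271 * min_work I k" if "k = i \<or> k = j" for k
      using that ij by (intro expectation_delay_bound_le I) auto
    ultimately have "?E (\<lambda>b. min (?g b i) (?g b j)) \<le> 2.152271 * min_work I k" if "k = i \<or> k = j" for k
      using that by (blast intro: order_trans)
    from this[of i] this[of j] show "?E (\<lambda>b. min (?g b i) (?g b j)) \<le> 2.152271 * min (min_work I i) (min_work I j)"
      by (simp add: min_def)
  qed (use expectation_work_le[OF I] in auto)
  also have "\<dots> = 2.152271 * (\<Sum>i<?n. \<Sum>j\<in>{..<?n} - {i}. min (min_work I i) (min_work I j)) / 2
      + real m * (1.434847 * W)"
    by (simp only: sum_distrib_left W_def)
  also have "(\<Sum>i<?n. \<Sum>j\<in>{..<?n} - {i}. min (min_work I i) (min_work I j)) = P - W"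
    unfolding P_def W_def sum_subtractf[symmetric]
    by (intro sum.cong refl) (simp add: sum_diff1)
  finally show ?thesis by simp
qed

section \<open>The competitive ratio and its limit\<close>

lemma rpcpm_competitive_ratio_bound:
  assumes m: "1 \<le> m"
  shows "rpcpm_competitive 2 (test_prob 2) m (ratio_bound m)"
  unfolding rpcpm_competitive_def
proof (intro allI impI, elim conjE)
  fix I \<sigma> assume I: "valid I" and run: "\<forall>b. rpcpm_run 2 m I b (\<sigma> b)"
  define P W where "P = (\<Sum>i<jobs I. \<Sum>j<jobs I. min (min_work I i) (min_work I j))"
    and "W = (\<Sum>j<jobs I. min_work I j)"
  have "2 * real m * expected_cost (test_prob 2) I \<sigma> \<le> 2.152271 * (P - W) + 2 * real m * 1.434847 * W"
    unfolding P_def W_def using run by (intro expected_cost_le I m) auto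
  \<comment> \<open>The coefficient of \<open>P\<close> fixes the share bounded through
    \<open>P + m * W \<le> 2 * m * opt\<close>; the remaining multiple of \<open>W\<close>,
    nonnegative for \<open>m \<ge> 1\<close>, is bounded through \<open>W \<le> opt\<close>.\<close>
  also have "\<dots> \<le> 2.152271 * (P + real m * W) + (real m - 1) * (2 * 1.434847 - 2.152271) * W"
  proof -
    have "0 \<le> W"
      unfolding W_def using min_work_pos[OF I] by (intro sum_nonneg) (auto simp: less_imp_le)
    \<comment> \<open>The slack \<open>1.434848\<close> is
      \<open>2 * (2.152271 - 1.434847)\<close>.\<close>
    moreover have "2.152271 * (P + real m * W) + (real m - 1) * (2 * 1.434847 - 2.152271) * W
        = 2.152271 * (P - W) + 2 * real m * 1.434847 * W + 1.434848 * W"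
      by (simp add: field_simps)
    ultimately show ?thesis by simp
  qed
  also have "\<dots> \<le> 2.152271 * (2 * real m * opt m I) + (real m - 1) * (2 * 1.434847 - 2.152271) * opt m I"
    using opt_lower_bound[OF I m] m unfolding P_def W_def by (intro add_mono mult_left_mono) auto
  also have "\<dots> = 2 * real m * (ratio_bound m * opt m I)"
    using m by (simp add: ratio_bound_def field_simps)
  finally show "expected_cost (test_prob 2) I \<sigma> \<le> ratio_bound m * opt m I"
    using m by simp
qed

theorem corollary25:
  "(\<forall>m\<ge>1. rpcpm_ratio 2 (test_prob 2) m \<le> ereal (ratio_bound m)) \<and>
   ratio_bound 1 = 2.152271 \<and>
   (\<exists>L. ratio_bound \<longlonglongrightarrow> L \<and> \<bar>L - 2.510983\<bar> \<le> 0.0000005)"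
proof (intro conjI allI impI exI)
  fix m :: nat assume "1 \<le> m"
  then show "rpcpm_ratio 2 (test_prob 2) m \<le> ereal (ratio_bound m)"
    unfolding rpcpm_ratio_def by (intro Inf_lower) (auto intro: rpcpm_competitive_ratio_bound)
next
  have "(\<lambda>m. 2.152271 * (1 / 2 + 1 / 2 * (1 / real m)) + 1.434847 * (1 - 1 / real m))
      \<longlonglongrightarrow> 2.152271 * (1 / 2 + 1 / 2 * 0) + 1.434847 * (1 - 0)"
    by (intro tendsto_intros lim_1_over_n)
  \<comment> \<open>The limit is exactly \<open>2.152271 / 2 + 1.434847\<close>; its distance to
    \<open>2.510983\<close> equals the tolerance.\<close>
  then show "ratio_bound \<longlonglongrightarrow> 2.5109825"
    by (simp add: ratio_bound_def[abs_def])
qed (simp_all add: ratio_bound_def)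

end
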